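(* Let $A,B\in M_{n\times n}(\mathbb{C})$ be self-adjoint such that $AB+BA=0$. Then $$\|A+B\|_p^p+\|A-B\|_p^p\;\geq\; \|\sigma(A)+\sigma(B)\|_p^p+\|\sigma(A)-\sigma(B)\|_p^p$$ for $1\leq p\leq 2$, with the inequality reversing for $2\leq p<\infty$.
   Context: For a matrix $X\in M_{n\times n}(\mathbb{C})$, $\|X\|_p=\operatorname{Tr}[(X^*X)^{p/2}]^{1/p}$ is the $p$-Schatten norm; for a vector $v\in\mathbb{R}^n$, $\|v\|_p=(\sum_i|v_i|^p)^{1/p}$. $\sigma(X)\in\mathbb{R}^n$ denotes the vector of singular values of $X$ (with multiplicity) in decreasing order. *)

theory Defs
  imports
    "HOL-Computational_Algebra.Fundamental_Theorem_Algebra"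
    "Jordan_Normal_Form.Schur_Decomposition"
begin

definition self_adjoint_mat :: "complex mat \<Rightarrow> bool" where
  "self_adjoint_mat A \<longleftrightarrow> square_mat A \<and> mat_adjoint A = A"

definition unitary_mat :: "complex mat \<Rightarrow> bool" where
  "unitary_mat U \<longleftrightarrow> square_mat U \<and> mat_adjoint U * U = 1\<^sub>m (dim_row U)"

definition mat_trace :: "complex mat \<Rightarrow> complex" where
  "mat_trace A = (\<Sum>i<dim_row A. A $$ (i, i))"

(* P^r for positive semidefinite P, by functional calculus: if
   P = U diag(d) U^* with U unitary and d >= 0, then P^r = U diag(d^r) U^*.
   The result does not depend on the choice of U and d: see psd_powr_eq.
   As 0 powr r = 0, this is the usual power for r > 0 (but not for r = 0). *)
definition psd_powr :: "complex mat \<Rightarrow> real \<Rightarrow> complex mat" where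
  "psd_powr P r = (let n = dim_row P in
     (THE Q. \<exists>U d. U \<in> carrier_mat n n \<and> unitary_mat U \<and> (\<forall>i<n. 0 \<le> d i) \<and>
        P = U * mat_diag n (\<lambda>i. complex_of_real (d i)) * mat_adjoint U \<and>
        Q = U * mat_diag n (\<lambda>i. complex_of_real (d i powr r)) * mat_adjoint U))"

(* The trace is a nonnegative real; Re only adjusts the type. *)
definition schatten_norm :: "real \<Rightarrow> complex mat \<Rightarrow> real" where
  "schatten_norm p X = (Re (mat_trace (psd_powr (mat_adjoint X * X) (p / 2)))) powr (1 / p)"

definition vec_pnorm :: "real \<Rightarrow> real vec \<Rightarrow> real" where
  "vec_pnorm p v = (\<Sum>i<dim_vec v. \<bar>v $ i\<bar> powr p) powr (1 / p)"

(* proots lists the roots of the characteristic polynomial with multiplicity, i.e.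
   the eigenvalues of X^* X, which are real and nonnegative. *)
definition singular_values :: "complex mat \<Rightarrow> real vec" where
  "singular_values X = vec_of_list (rev (sorted_list_of_multiset
     (image_mset (\<lambda>z. sqrt (Re z)) (proots (char_poly (mat_adjoint X * X))))))"

lemma mat_adjoint_dims [simp]:
  "dim_row (mat_adjoint A) = dim_col A" "dim_col (mat_adjoint A) = dim_row A"
  by (simp_all add: mat_adjoint_def)

lemma mat_adjoint_carrier [simp]:
  "A \<in> carrier_mat m n \<Longrightarrow> mat_adjoint A \<in> carrier_mat n m"
  by (rule carrier_matI) (simp_all only: mat_adjoint_dims carrier_matD)

lemma dim_singular_values:
  assumes "X \<in> carrier_mat m n"
  shows "dim_vec (singular_values X) = n"
proof -
  have c: "mat_adjoint X * X \<in> carrier_mat n n" using assms by auto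
  have "size (proots (char_poly (mat_adjoint X * X))) = n"
    using degree_monic_char_poly[OF c] by (simp add: size_proots_complex)
  then show ?thesis
    by (simp only: singular_values_def dim_vec_of_list length_rev
        size_mset[symmetric] mset_rev mset_sorted_list_of_multiset size_image_mset)
qed

lemma unitary_mat_right:
  assumes "U \<in> carrier_mat n n" "unitary_mat U"
  shows "mat_adjoint U * U = 1\<^sub>m n" "U * mat_adjoint U = 1\<^sub>m n"
proof -
  show *: "mat_adjoint U * U = 1\<^sub>m n" using assms(2) by (simp only: unitary_mat_def carrier_matD[OF assms(1)])
  show "U * mat_adjoint U = 1\<^sub>m n"
    by (rule mat_mult_left_right_inverse[OF mat_adjoint_carrier[OF assms(1)] assms(1) *])
qed

lemma assoc_mult_mat5:
  fixes P :: "'a :: semiring_1 mat"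
  assumes c: "P \<in> carrier_mat n n" "U \<in> carrier_mat n n" "D \<in> carrier_mat n n"
    "Q \<in> carrier_mat n n" "V \<in> carrier_mat n n"
  shows "P * (U * D * Q) * V = (P * U) * D * (Q * V)"
proof -
  note m = mult_carrier_mat[of _ n n _ n]
  note a = assoc_mult_mat[of _ n n _ n _ n]
  have "P * (U * D * Q) * V = P * (U * (D * Q)) * V"
    by (simp only: a[OF c(2,3,4)])
  also have "\<dots> = (P * U) * (D * Q) * V"
    by (simp only: a[OF c(1,2) m[OF c(3,4)]])
  also have "\<dots> = (P * U) * D * Q * V"
    by (simp only: a[OF m[OF c(1,2)] c(3,4)])
  also have "\<dots> = (P * U) * D * (Q * V)"
    by (simp only: a[OF m[OF m[OF c(1,2)] c(3)] c(4,5)])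
  finally show ?thesis .
qed

lemma spectral_function_unique:
  fixes d e :: "nat \<Rightarrow> real" and f :: "real \<Rightarrow> real"
  assumes U: "U \<in> carrier_mat n n" "unitary_mat U"
    and V: "V \<in> carrier_mat n n" "unitary_mat V"
    and eq: "U * mat_diag n (\<lambda>i. complex_of_real (d i)) * mat_adjoint U
           = V * mat_diag n (\<lambda>i. complex_of_real (e i)) * mat_adjoint V"
  shows "U * mat_diag n (\<lambda>i. complex_of_real (f (d i))) * mat_adjoint U
       = V * mat_diag n (\<lambda>i. complex_of_real (f (e i))) * mat_adjoint V"
proof -
  note uu = unitary_mat_right[OF U] and vv = unitary_mat_right[OF V]
  define W where "W = mat_adjoint U * V"
  have aU: "mat_adjoint U \<in> carrier_mat n n" and aV: "mat_adjoint V \<in> carrier_mat n n"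
    using U V by auto
  have W: "W \<in> carrier_mat n n" using aU V by (simp add: W_def)
  let ?D = "\<lambda>d. mat_diag n (\<lambda>i. complex_of_real (d i))"
  have D: "?D d \<in> carrier_mat n n" for d by simp
  have conv: "mat_adjoint U * (U * ?D d * mat_adjoint U) * V = ?D d * W" for d
    using assoc_mult_mat5[OF aU U(1) D aU V(1), of d] left_mult_one_mat[OF D, of d]
    by (simp only: uu W_def)
  have conv2: "mat_adjoint U * (V * ?D d * mat_adjoint V) * V = W * ?D d" for d
    using assoc_mult_mat5[OF aU V(1) D aV V(1), of d]
      right_mult_one_mat[OF mult_carrier_mat[OF W D], of d]
    by (simp only: vv W_def)
  have DW: "?D d * W = W * ?D e"
    by (simp only: conv[of d, symmetric] conv2[of e, symmetric] eq)
  have "?D (f \<circ> d) * W = W * ?D (f \<circ> e)"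
  proof (rule eq_matI)
    fix i j assume "i < dim_row (W * ?D (f \<circ> e))" "j < dim_col (W * ?D (f \<circ> e))"
    then have ij: "i < n" "j < n" using W by (auto simp: mat_diag_def)
    have "(?D d * W) $$ (i,j) = (W * ?D e) $$ (i,j)" by (simp add: DW)
    then have "complex_of_real (d i) * W $$ (i,j) = W $$ (i,j) * complex_of_real (e j)"
      using ij W by (simp add: mat_diag_mult_left[of _ n n] mat_diag_mult_right[of _ n n])
    then have "W $$ (i,j) = 0 \<or> d i = e j" by auto
    then show "(?D (f \<circ> d) * W) $$ (i,j) = (W * ?D (f \<circ> e)) $$ (i,j)"
      using ij W by (auto simp: mat_diag_mult_left[of _ n n] mat_diag_mult_right[of _ n n])
  qed (use W in \<open>auto simp: mat_diag_def\<close>)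
  then have key: "mat_adjoint U * (U * ?D (f \<circ> d) * mat_adjoint U) * V
     = mat_adjoint U * (V * ?D (f \<circ> e) * mat_adjoint V) * V"
    by (simp only: conv conv2)
  have strip: "U * (mat_adjoint U * M * V) * mat_adjoint V = M" if M: "M \<in> carrier_mat n n" for M
    using assoc_mult_mat5[OF U(1) aU M V(1) aV] left_mult_one_mat[OF M] right_mult_one_mat[OF M]
    by (simp only: uu vv)
  have car: "U * ?D (f \<circ> d) * mat_adjoint U \<in> carrier_mat n n"
    "V * ?D (f \<circ> e) * mat_adjoint V \<in> carrier_mat n n"
    by (intro mult_carrier_mat[OF mult_carrier_mat[OF U(1) D] aU]
        mult_carrier_mat[OF mult_carrier_mat[OF V(1) D] aV])+
  have "U * ?D (f \<circ> d) * mat_adjoint U = V * ?D (f \<circ> e) * mat_adjoint V"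
    using arg_cong[OF key, of "\<lambda>M. U * M * mat_adjoint V"]
    by (simp only: strip[OF car(1)] strip[OF car(2)])
  then show ?thesis by (simp only: comp_def)
qed

lemma psd_powr_eq:
  assumes U: "U \<in> carrier_mat n n" "unitary_mat U" and d: "\<And>i. i < n \<Longrightarrow> 0 \<le> d i"
  shows "psd_powr (U * mat_diag n (\<lambda>i. complex_of_real (d i)) * mat_adjoint U) r
       = U * mat_diag n (\<lambda>i. complex_of_real (d i powr r)) * mat_adjoint U"
proof -
  let ?S = "\<lambda>U d. U * mat_diag n (\<lambda>i. complex_of_real (d i)) * mat_adjoint U"
  let ?P = "\<lambda>Q. \<exists>V e. V \<in> carrier_mat n n \<and> unitary_mat V \<and> (\<forall>i<n. 0 \<le> e i) \<and>
    ?S U d = ?S V e \<and> Q = ?S V (\<lambda>i. e i powr r)"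
  have n: "dim_row (?S U d) = n"
    by (simp only: index_mult_mat carrier_matD[OF U(1)])
  have ex: "?P (?S U (\<lambda>i. d i powr r))"
    by (rule exI[of _ U], rule exI[of _ d], intro conjI U refl allI impI d)
  have un: "Q = ?S U (\<lambda>i. d i powr r)" if "?P Q" for Q
  proof -
    from that obtain V e where V: "V \<in> carrier_mat n n" "unitary_mat V"
      and eq: "?S U d = ?S V e" and Q: "Q = ?S V (\<lambda>i. e i powr r)"
      by (elim exE conjE)
    show ?thesis
      unfolding Q by (rule spectral_function_unique[OF U V eq, of "\<lambda>x. x powr r", symmetric])
  qed
  show ?thesis
    unfolding psd_powr_def Let_def n by (rule the_equality[of ?P, OF ex un])
qed

end

theory Submission
  imports Defs
begin

text \<open>
  Anticommutation gives \<open>(A \<plusminus> B)\<^sup>2 = A\<^sup>2 + B\<^sup>2\<close> and makes \<open>A\<^sup>2\<close> and \<open>B\<^sup>2\<close> commute. A unitary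
  Schur basis of the normal matrix \<open>A\<^sup>2 + \<i> B\<^sup>2\<close> diagonalizes both, so the left-hand side is
  \<open>2 \<Sum> h (a\<^sub>i\<^sup>2 + b\<^sub>i\<^sup>2)\<close> with \<open>h x = x powr (p / 2)\<close>, where \<open>a\<close>, \<open>b\<close> list the singular values of
  \<open>A\<close>, \<open>B\<close> in some order. For \<open>p \<ge> 2\<close> the function \<open>h\<close> has nondecreasing increments. Hence
  \<open>h (x\<^sup>2 + y\<^sup>2)\<close> is supermodular and the sum can only grow when both lists are sorted, and, as
  \<open>x\<^sup>2 + y\<^sup>2\<close> is the midpoint of \<open>(x + y)\<^sup>2\<close> and \<open>(x - y)\<^sup>2\<close>,
  \<open>2 h (x\<^sup>2 + y\<^sup>2) \<le> h ((x + y)\<^sup>2) + h ((x - y)\<^sup>2)\<close>. For \<open>p \<le> 2\<close> apply the same to \<open>-h\<close>.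
\<close>

section \<open>Rearrangement\<close>

text \<open>The increment has derivative \<open>q * ((x + s) powr (q - 1) - x powr (q - 1))\<close>,
  whose sign follows from the monotonicity of the power with exponent \<open>q - 1\<close>.\<close>

lemma powr_increment:
  fixes a b s q :: real
  assumes "0 < q" "0 \<le> a" "a \<le> b" "0 \<le> s"
  shows "1 \<le> q \<Longrightarrow> (a + s) powr q - a powr q \<le> (b + s) powr q - b powr q"
    and "q \<le> 1 \<Longrightarrow> (b + s) powr q - b powr q \<le> (a + s) powr q - a powr q"
proof -
  let ?f = "\<lambda>x. (x + s) powr q - x powr q"
  let ?f' = "\<lambda>x. q * ((x + s) powr (q - 1) - x powr (q - 1))"
  \<comment> \<open>The endpoint \<open>a\<close> may be 0, so it is covered by continuity; the
    derivative is computed only to the right of \<open>a\<close>.\<close>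
  have cont: "continuous_on {a..b} ?f"
    using assms by (intro continuous_intros continuous_on_powr') auto
  have der: "DERIV ?f x :> ?f' x" if "a < x" for x
    using that assms by (auto intro!: derivative_eq_intros simp: algebra_simps)
  show "?f a \<le> ?f b" if "1 \<le> q"
  proof (rule DERIV_nonneg_imp_increasing_open[OF assms(3) _ cont])
    fix x assume x: "a < x" "x < b"
    have "x powr (q - 1) \<le> (x + s) powr (q - 1)"
      using x assms that by (intro powr_mono2) auto
    then show "\<exists>y. DERIV ?f x :> y \<and> 0 \<le> y"
      using der[OF x(1)] assms(1) by (intro exI[of _ "?f' x"]) auto
  qed
  show "?f b \<le> ?f a" if "q \<le> 1"
  proof (rule DERIV_nonpos_imp_decreasing_open[OF assms(3) _ cont])
    fix x assume x: "a < x" "x < b"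
    have "(x + s) powr (q - 1) \<le> x powr (q - 1)"
      using x assms that by (intro powr_mono2') auto
    then show "\<exists>y. DERIV ?f x :> y \<and> y \<le> 0"
      using der[OF x(1)] assms(1) by (intro exI[of _ "?f' x"]) (auto simp: mult_nonneg_nonpos)
  qed
qed

section \<open>Rearrangement inequality for supermodular functions\<close>

context
  fixes g :: "'a::linorder \<Rightarrow> 'b::linorder \<Rightarrow> real" and X :: "'a set" and Y :: "'b set"
  assumes supermodular: "\<And>x x' y y'. \<lbrakk>x \<in> X; x' \<in> X; y \<in> Y; y' \<in> Y; x \<le> x'; y \<le> y'\<rbrakk>
    \<Longrightarrow> g x y' + g x' y \<le> g x y + g x' y'"
begin

text \<open>Here \<open>x\<close> is a lower bound of \<open>xs\<close>. While \<open>insort\<close>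
  carries \<open>y\<close> past smaller entries, each exchange moves \<open>y\<close> to a larger
  partner, which supermodularity rewards.\<close>

lemma sum_list_map2_insort:
  assumes "sorted (x # xs)" "set (x # xs) \<subseteq> X" "set (y # ys) \<subseteq> Y" "length xs = length ys"
  shows "g x y + sum_list (map2 g xs ys) \<le> sum_list (map2 g (x # xs) (insort y ys))"
  using assms
proof (induction ys arbitrary: x xs)
  case (Cons z zs)
  then obtain x' xs' where xs: "xs = x' # xs'" by (cases xs) auto
  show ?case
  proof (cases "y \<le> z")
    case False
    \<comment> \<open>Since \<open>x \<le> x'\<close> and \<open>z \<le> y\<close>, the smaller
      entry \<open>z\<close> goes to \<open>x\<close>; the induction then continues inserting
      \<open>y\<close>, now paired with \<open>x'\<close>.\<close>
    have "g x y + g x' z \<le> g x z + g x' y"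
      using supermodular[of x x' z y] False Cons.prems xs by auto
    moreover have "g x' y + sum_list (map2 g xs' zs) \<le> sum_list (map2 g (x' # xs') (insort y zs))"
      using Cons.prems xs by (intro Cons.IH) auto
    ultimately show ?thesis using False xs by simp
  qed simp
qed simp

text \<open>Insertion sort performs one \<open>insort\<close> per entry, and none of them lowers the
  sum.\<close>

lemma sum_list_map2_sort_right:
  assumes "sorted xs" "set xs \<subseteq> X" "set ys \<subseteq> Y" "length xs = length ys"
  shows "sum_list (map2 g xs ys) \<le> sum_list (map2 g xs (sort ys))"
  using assms
proof (induction ys arbitrary: xs)
  case (Cons y ys)
  then obtain x xs' where xs: "xs = x # xs'" by (cases xs) auto
  have "g x y + sum_list (map2 g xs' ys) \<le> g x y + sum_list (map2 g xs' (sort ys))"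
    using Cons xs by simp
  also have "\<dots> \<le> sum_list (map2 g (x # xs') (insort y (sort ys)))"
    using Cons.prems xs by (intro sum_list_map2_insort) auto
  finally show ?case using xs by simp
qed simp

lemma sum_list_map2_sort:
  assumes "set xs \<subseteq> X" "set ys \<subseteq> Y" "length xs = length ys"
  shows "sum_list (map2 g xs ys) \<le> sum_list (map2 g (sort xs) (sort ys))"
proof -
  \<comment> \<open>The sum depends only on the multiset of pairs. Ordering the pairs by first
    component sorts \<open>xs\<close> for free and leaves one list to sort.\<close>
  define ps where "ps = sort_key fst (zip xs ys)"
  have mset: "mset ps = mset (zip xs ys)" by (simp add: ps_def)
  have m: "mset (map fst ps) = mset xs" "mset (map snd ps) = mset ys"
    using assms(3) by (metis mset mset_map map_fst_zip, metis mset mset_map map_snd_zip)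
  have "sorted (map fst ps)" by (simp add: ps_def)
  then have sort: "map fst ps = sort xs" "sort (map snd ps) = sort ys"
    using properties_for_sort[OF m(1)] properties_for_sort[of "sort ys" "map snd ps"] m(2)
    by simp_all
  have set: "set (map fst ps) = set xs" "set (map snd ps) = set ys"
    using m by (metis mset_eq_setD)+
  have "sum_list (map2 g xs ys) = sum_list (map2 g (map fst ps) (map snd ps))"
    using arg_cong[OF mset, of "\<lambda>M. \<Sum>\<^sub># (image_mset (\<lambda>(x, y). g x y) M)"]
    by (simp add: zip_map_fst_snd sum_mset_sum_list flip: mset_map)
  also have "\<dots> \<le> sum_list (map2 g (map fst ps) (sort (map snd ps)))"
    using assms set by (intro sum_list_map2_sort_right) (auto simp: ps_def)
  finally show ?thesis by (simp add: sort)
qed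

end

text \<open>An abstract \<open>h\<close> lets one argument serve both ranges of \<open>p\<close>.
  The lists are reversed to match the decreasing order of \<open>singular_values\<close>.\<close>

lemma sum_squares_rearrangement:
  fixes a b :: "nat \<Rightarrow> real" and h :: "real \<Rightarrow> real" and n :: nat
  assumes inc: "\<And>x y s. 0 \<le> x \<Longrightarrow> x \<le> y \<Longrightarrow> 0 \<le> s \<Longrightarrow> h (x + s) - h x \<le> h (y + s) - h y"
    and nonneg: "\<And>i. 0 \<le> a i" "\<And>i. 0 \<le> b i"
  defines "S \<equiv> rev (sort (map a [0..<n]))" and "T \<equiv> rev (sort (map b [0..<n]))"
  shows "2 * (\<Sum>i<n. h ((a i)\<^sup>2 + (b i)\<^sup>2))
    \<le> (\<Sum>i<n. h ((S ! i + T ! i)\<^sup>2) + h ((S ! i - T ! i)\<^sup>2))"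
proof -
  let ?g = "\<lambda>x y. h (x\<^sup>2 + y\<^sup>2)"
  have super: "?g x y' + ?g x' y \<le> ?g x y + ?g x' y'"
    if "x \<in> {0..}" "x' \<in> {0..}" "y \<in> {0..}" "y' \<in> {0..}" "x \<le> x'" "y \<le> y'" for x x' y y'
  proof -
    \<comment> \<open>Supermodularity compares the increments of \<open>h\<close> over the step
      \<open>y'\<^sup>2 - y\<^sup>2\<close>, starting from \<open>x\<^sup>2 + y\<^sup>2\<close> and
      from \<open>x'\<^sup>2 + y\<^sup>2\<close>.\<close>
    have "x\<^sup>2 \<le> x'\<^sup>2" "y\<^sup>2 \<le> y'\<^sup>2" using that by (auto intro: power_mono)
    then show ?thesis
      using inc[of "x\<^sup>2 + y\<^sup>2" "x'\<^sup>2 + y\<^sup>2" "y'\<^sup>2 - y\<^sup>2"] by (simp add: algebra_simps)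
  qed
  have mid: "2 * ?g x y \<le> h ((x + y)\<^sup>2) + h ((x - y)\<^sup>2)" if "0 \<le> x" "0 \<le> y" for x y
  proof -
    \<comment> \<open>Two consecutive steps of length \<open>2 * x * y\<close> lead from
      \<open>(x - y)\<^sup>2\<close> through the midpoint to \<open>(x + y)\<^sup>2\<close>.\<close>
    have "(x - y)\<^sup>2 \<le> x\<^sup>2 + y\<^sup>2" "(x - y)\<^sup>2 + 2 * x * y = x\<^sup>2 + y\<^sup>2"
      "x\<^sup>2 + y\<^sup>2 + 2 * x * y = (x + y)\<^sup>2"
      using that by (simp_all add: power2_diff power2_sum)
    then show ?thesis
      using inc[of "(x - y)\<^sup>2" "x\<^sup>2 + y\<^sup>2" "2 * x * y"] that by simp
  qed
  have S: "S ! i \<ge> 0" and T: "T ! i \<ge> 0" if "i < n" for i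
    using that nth_mem[of i S] nth_mem[of i T] nonneg by (auto simp: S_def T_def)
  have len: "length S = n" "length T = n" by (simp_all add: S_def T_def)
  have "(\<Sum>i<n. ?g (a i) (b i)) = sum_list (map2 ?g (map a [0..<n]) (map b [0..<n]))"
    by (simp add: sum_list_sum_nth atLeast0LessThan)
  also have "\<dots> \<le> sum_list (map2 ?g (sort (map a [0..<n])) (sort (map b [0..<n])))"
    using nonneg by (intro sum_list_map2_sort[of "{0..}" "{0..}"] super) auto
  \<comment> \<open>Reversing both lists together keeps every pair.\<close>
  also have "\<dots> = sum_list (map2 ?g S T)"
    by (simp add: S_def T_def zip_rev rev_map[symmetric])
  also have "\<dots> = (\<Sum>i<n. ?g (S ! i) (T ! i))"
    by (simp add: sum_list_sum_nth len atLeast0LessThan)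
  finally have "2 * (\<Sum>i<n. ?g (a i) (b i)) \<le> (\<Sum>i<n. 2 * ?g (S ! i) (T ! i))"
    by (simp flip: sum_distrib_left)
  also have "\<dots> \<le> (\<Sum>i<n. h ((S ! i + T ! i)\<^sup>2) + h ((S ! i - T ! i)\<^sup>2))"
    using mid S T by (intro sum_mono) auto
  finally show ?thesis .
qed

lemma powr_half_square: "(u\<^sup>2) powr (p / 2) = \<bar>u::real\<bar> powr p"
proof (cases "u = 0")
  case False
  then have "u\<^sup>2 = \<bar>u\<bar> powr 2" by (simp add: powr_numeral)
  then have "(u\<^sup>2) powr (p / 2) = (\<bar>u\<bar> powr 2) powr (p / 2)" by simp
  also have "\<dots> = \<bar>u\<bar> powr p" by (simp only: powr_powr) simp
  finally show ?thesis .
qed simp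

section \<open>Simultaneous unitary diagonalization\<close>

lemma mat_adjoint_index [simp]:
  "i < dim_col A \<Longrightarrow> j < dim_row A \<Longrightarrow> mat_adjoint A $$ (i, j) = conjugate (A $$ (j, i))"
  by (simp add: mat_adjoint_def mat_of_rows_index)

lemma mat_adjoint_adjoint [simp]: "mat_adjoint (mat_adjoint A) = (A :: complex mat)"
  by (rule eq_matI) auto

lemma mat_adjoint_mult:
  fixes A B :: "complex mat"
  assumes "A \<in> carrier_mat m n" "B \<in> carrier_mat n k"
  shows "mat_adjoint (A * B) = mat_adjoint B * mat_adjoint A"
  using assms by (intro eq_matI) (auto simp: scalar_prod_def intro!: sum.cong)

lemma unitary_matI:
  "U \<in> carrier_mat n n \<Longrightarrow> mat_adjoint U * U = 1\<^sub>m n \<Longrightarrow> unitary_mat U"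
  by (auto simp: unitary_mat_def)

lemma unitary_mat_mult:
  assumes U: "U \<in> carrier_mat n n" "unitary_mat U" and V: "V \<in> carrier_mat n n" "unitary_mat V"
  shows "unitary_mat (U * V)"
proof (rule unitary_matI)
  have aU: "mat_adjoint U \<in> carrier_mat n n" and aV: "mat_adjoint V \<in> carrier_mat n n"
    using U V by auto
  show "U * V \<in> carrier_mat n n" using U V by auto
  have "mat_adjoint (U * V) * (U * V) = mat_adjoint V * (mat_adjoint U * 1\<^sub>m n * U) * V"
    using assoc_mult_mat[OF aV aU mult_carrier_mat[OF U(1) V(1)]]
      assoc_mult_mat[OF aV mult_carrier_mat[OF aU U(1)] V(1)]
      assoc_mult_mat[OF aU U(1) V(1)] right_mult_one_mat[OF aU]
    by (simp only: mat_adjoint_mult[OF U(1) V(1)])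
  also have "\<dots> = 1\<^sub>m n"
    using unitary_mat_right[OF U] unitary_mat_right[OF V] right_mult_one_mat[OF aU]
      right_mult_one_mat[OF aV]
    by simp
  finally show "mat_adjoint (U * V) * (U * V) = 1\<^sub>m n" .
qed

lemma adjoint_conj_mult:
  fixes A U V :: "complex mat"
  assumes U: "U \<in> carrier_mat n n" and V: "V \<in> carrier_mat n n" and A: "A \<in> carrier_mat n n"
  shows "mat_adjoint (U * V) * A * (U * V) = mat_adjoint V * (mat_adjoint U * A * U) * V"
proof -
  have aU: "mat_adjoint U \<in> carrier_mat n n" and aV: "mat_adjoint V \<in> carrier_mat n n"
    using U V by auto
  show ?thesis
    by (simp only: mat_adjoint_mult[OF U V] assoc_mult_mat5[OF aV aU A U V])
qed

text \<open>Complete an eigenvector to a basis, orthogonalize and normalize. The first column of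
  \<open>W\<close> stays an eigenvector, so the conjugated matrix has first column \<open>e\<close>
  times the first unit vector.\<close>

lemma unitary_eigenbasis_exists:
  fixes A :: "complex mat"
  assumes A: "A \<in> carrier_mat n n" and n: "n \<noteq> 0"
  shows "\<exists>W e. W \<in> carrier_mat n n \<and> unitary_mat W \<and>
    (\<forall>i<n. (mat_adjoint W * A * W) $$ (i, 0) = (if i = 0 then e else 0))"
proof -
  have "degree (char_poly A) \<noteq> 0" using degree_monic_char_poly[OF A] n by simp
  then obtain e where "poly (char_poly A) e = 0"
    using fundamental_theorem_of_algebra[of "char_poly A"] by (auto simp: constant_degree)
  then have "eigenvalue A e" by (simp add: eigenvalue_root_char_poly[OF A])
  then obtain v where v: "v \<in> carrier_vec n" "v \<noteq> 0\<^sub>v n" "A *\<^sub>v v = e \<cdot>\<^sub>v v"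
    using A by (auto simp: eigenvalue_def eigenvector_def)
  interpret cof_vec_space n "TYPE(complex)" .
  define b where "b = basis_completion v"
  have b: "distinct b" "\<not> lin_dep (set b)" "set b \<subseteq> carrier_vec n" "hd b = v" "length b = n"
    using basis_completion[OF v(1,2)] by (auto simp: b_def)
  then obtain vs where bv: "b = v # vs" using n by (cases b) auto
  define ws where "ws = gram_schmidt n b"
  have ws: "set ws \<subseteq> carrier_vec n" "corthogonal ws" "length ws = n"
    using gram_schmidt_result[OF b(3,1,2) refl, folded ws_def] b by auto
  have "hd ws = v" using gram_schmidt_hd[OF v(1), of vs, folded bv] by (simp add: ws_def)
  then have ws0: "ws ! 0 = v" using ws(3) n by (cases ws) auto
  \<comment> \<open>\<open>gram_schmidt\<close> yields orthogonal vectors that are not normalized;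
    \<open>c j\<close> is the squared length by which \<open>W\<close> is scaled below.\<close>
  define c where "c j = Re (ws ! j \<bullet>c ws ! j)" for j
  have wsc: "ws ! j \<in> carrier_vec n" if "j < n" for j using ws that by auto
  have orth: "ws ! i \<bullet>c ws ! j = (if i = j then complex_of_real (c j) else 0)" "0 < c j"
    if "i < n" "j < n" for i j
  proof -
    \<comment> \<open>In the order on complex numbers this also says that the product is real, hence
      equal to \<open>c j\<close>.\<close>
    have ge: "ws ! j \<bullet>c ws ! j \<ge> 0" by (rule conjugate_square_ge_0_vec)
    have "ws ! j \<bullet>c ws ! j \<noteq> 0" using corthogonalD[OF ws(2)] that ws(3) by auto
    with ge show "0 < c j" by (auto simp: c_def less_eq_complex_def complex_eq_iff)
    show "ws ! i \<bullet>c ws ! j = (if i = j then complex_of_real (c j) else 0)"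
      using ge corthogonalD[OF ws(2), of i j] that ws(3)
      by (auto simp: c_def less_eq_complex_def complex_eq_iff)
  qed
  define W where "W = mat n n (\<lambda>(i, j). ws ! j $ i / complex_of_real (sqrt (c j)))"
  have W: "W \<in> carrier_mat n n" by (simp add: W_def)
  have colW: "col W j = (1 / complex_of_real (sqrt (c j))) \<cdot>\<^sub>v ws ! j" if "j < n" for j
    using that wsc[OF that] by (intro eq_vecI) (auto simp: W_def)
  have rowW: "row (mat_adjoint W) i = conjugate (col W i)" if "i < n" for i
    using that W by (intro eq_vecI) auto
  have unit: "conjugate (col W i) \<bullet> col W j = (if i = j then 1 else 0)" if "i < n" "j < n" for i j
  proof -
    have "conjugate (col W i) \<bullet> col W j
      = ws ! j \<bullet>c ws ! i / (complex_of_real (sqrt (c i)) * complex_of_real (sqrt (c j)))"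
      using that wsc[OF that(1)] wsc[OF that(2)]
      by (simp add: scalar_prod_def W_def sum_divide_distrib) 
         (auto intro!: sum.cong simp: mult.commute)
    also have "\<dots> = (if i = j then 1 else 0)"
      using orth[of j i] orth[of i i] that
      by (auto simp flip: of_real_mult)
    finally show ?thesis .
  qed
  have U: "mat_adjoint W * W = 1\<^sub>m n"
    using W by (intro eq_matI) (auto simp: rowW unit)
  have "col (A * W) 0 = A *\<^sub>v col W 0" using A W n by (intro col_mult2) auto
  also have "\<dots> = e \<cdot>\<^sub>v col W 0"
    using colW[of 0] n v A by (simp add: ws0 mult_mat_vec smult_smult_assoc mult.commute)
  finally have col0: "col (A * W) 0 = e \<cdot>\<^sub>v col W 0" .
  have "(mat_adjoint W * A * W) $$ (i, 0) = (if i = 0 then e else 0)" if i: "i < n" for i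
  proof -
    have "mat_adjoint W * A * W = mat_adjoint W * (A * W)"
      by (rule assoc_mult_mat[OF mat_adjoint_carrier[OF W] A W])
    then have "(mat_adjoint W * A * W) $$ (i, 0) = conjugate (col W i) \<bullet> col (A * W) 0"
      using A W i n by (simp add: rowW)
    also have "\<dots> = e * (conjugate (col W i) \<bullet> col W 0)"
      using W i n by (subst col0) (intro scalar_prod_smult_distrib[of _ n], auto)
    finally show ?thesis using unit[OF i, of 0] n by auto
  qed
  then show ?thesis using W U unitary_matI by blast
qed

text \<open>Deflation: split off one eigenvector and triangularize the remaining block of size
  \<open>m\<close> by induction.\<close>

lemma unitary_schur:
  fixes A :: "complex mat"
  assumes "A \<in> carrier_mat n n"
  shows "\<exists>U. U \<in> carrier_mat n n \<and> unitary_mat U \<and> upper_triangular (mat_adjoint U * A * U)"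
  using assms
proof (induction n arbitrary: A)
  case 0
  then show ?case
    by (intro exI[of _ "1\<^sub>m 0"]) (auto simp: unitary_mat_def)
next
  case (Suc m)
  obtain W e where W: "W \<in> carrier_mat (Suc m) (Suc m)" "unitary_mat W"
    and col0: "\<And>i. i < Suc m \<Longrightarrow> (mat_adjoint W * A * W) $$ (i, 0) = (if i = 0 then e else 0)"
    using unitary_eigenbasis_exists[OF Suc.prems] by blast
  define N where "N = mat_adjoint W * A * W"
  have N: "N \<in> carrier_mat (Suc m) (Suc m)" using W Suc.prems by (auto simp: N_def)
  define R where "R = mat 1 m (\<lambda>(i, j). N $$ (0, Suc j))"
  define A' where "A' = mat m m (\<lambda>(i, j). N $$ (Suc i, Suc j))"
  define E where "E = mat 1 1 (\<lambda>_. e)"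
  have car: "R \<in> carrier_mat 1 m" "A' \<in> carrier_mat m m" "E \<in> carrier_mat 1 1"
    by (auto simp: R_def A'_def E_def)
  have Nblock: "N = four_block_mat E R (0\<^sub>m m 1) A'"
    using N col0[folded N_def] by (intro eq_matI) (auto simp: E_def R_def A'_def)
  obtain U where U: "U \<in> carrier_mat m m" "unitary_mat U"
    and ut: "upper_triangular (mat_adjoint U * A' * U)"
    using Suc.IH[OF car(2)] by blast
  have aU: "mat_adjoint U \<in> carrier_mat m m" using U by simp
  \<comment> \<open>\<open>V\<close> fixes the split-off eigenvector and applies \<open>U\<close> to
    its complement, so it keeps the corner \<open>E\<close> and the zero block while triangularizing
    \<open>A'\<close>.\<close>
  define V where "V = four_block_mat (1\<^sub>m 1) (0\<^sub>m 1 m) (0\<^sub>m m 1) U"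
  have V: "V \<in> carrier_mat (Suc m) (Suc m)" using U by (auto simp: V_def)
  have aV: "mat_adjoint V = four_block_mat (1\<^sub>m 1) (0\<^sub>m 1 m) (0\<^sub>m m 1) (mat_adjoint U)"
    using U by (intro eq_matI) (auto simp: V_def)
  have "mat_adjoint V * V = four_block_mat (1\<^sub>m 1) (0\<^sub>m 1 m) (0\<^sub>m m 1) (mat_adjoint U * U)"
    unfolding aV
    by (subst V_def, subst mult_four_block_mat[of _ 1 1 _ m _ m _ _ 1 _ m]) (use U aU in auto)
  then have "mat_adjoint V * V = 1\<^sub>m (Suc m)"
    using unitary_mat_right(1)[OF U] by simp
  then have uV: "unitary_mat V" using V by (intro unitary_matI)
  have "mat_adjoint V * N = four_block_mat E R (0\<^sub>m m 1) (mat_adjoint U * A')"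
    unfolding aV Nblock
    by (subst mult_four_block_mat[of _ 1 1 _ m _ m _ _ 1 _ m]) (use U aU car in auto)
  then have "mat_adjoint V * N * V = four_block_mat E (R * U) (0\<^sub>m m 1) (mat_adjoint U * A' * U)"
    unfolding V_def
    by (simp, subst mult_four_block_mat[of _ 1 1 _ m _ m _ _ 1 _ m]) (use U aU car in auto)
  moreover have "upper_triangular \<dots>"
    using U aU car by (intro upper_triangular_four_block[of _ 1 _ m] ut) (auto simp: E_def)
  ultimately have "upper_triangular (mat_adjoint (W * V) * A * (W * V))"
    using adjoint_conj_mult[OF W(1) V Suc.prems] by (simp add: N_def)
  then show ?case
    using W V uV by (intro exI[of _ "W * V"]) (auto intro: unitary_mat_mult)
qed

text \<open>By induction on the row: column \<open>i\<close> vanishes below the diagonal by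
  triangularity and above it by the earlier rows. Equal norms of row \<open>i\<close> and column
  \<open>i\<close> then clear the rest of row \<open>i\<close>.\<close>

lemma normal_triangular_offdiag:
  fixes t :: "nat \<Rightarrow> nat \<Rightarrow> complex"
  assumes tri: "\<And>i j. j < i \<Longrightarrow> i < n \<Longrightarrow> t i j = 0"
    and normal: "\<And>i. i < n \<Longrightarrow> (\<Sum>k<n. (cmod (t i k))\<^sup>2) = (\<Sum>k<n. (cmod (t k i))\<^sup>2)"
    and "i < n" "j < n" "i \<noteq> j"
  shows "t i j = 0"
  using assms(3-5)
proof (induction i arbitrary: j rule: less_induct)
  case (less i)
  have "t k i = 0" if "k < n" "k \<noteq> i" for k
    using that less tri[of i k] by (cases "k < i") auto
  then have "(\<Sum>k\<in>{..<n} - {i}. (cmod (t k i))\<^sup>2) = 0"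
    by (intro sum.neutral) auto
  then have "(\<Sum>k\<in>{..<n} - {i}. (cmod (t i k))\<^sup>2) = 0"
    using normal[OF less.prems(1)] less.prems(1) by (simp add: sum.remove[of _ i])
  then show ?case
    using less.prems by (subst (asm) sum_nonneg_eq_0_iff) auto
qed

text \<open>\<^term>\<open>K + \<i> \<cdot>\<^sub>m L\<close> is normal because \<open>K\<close> and \<open>L\<close> commute, and a normal triangular matrix is diagonal.\<close>

lemma commuting_hermitian_triangular:
  fixes K L :: "complex mat"
  assumes K: "K \<in> carrier_mat n n" "mat_adjoint K = K"
    and L: "L \<in> carrier_mat n n" "mat_adjoint L = L"
    and comm: "K * L = L * K"
    and tri: "upper_triangular (K + \<i> \<cdot>\<^sub>m L)"
  shows "diagonal_mat K" "diagonal_mat L"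
proof -
  define t where "t i j = K $$ (i, j) + \<i> * L $$ (i, j)" for i j
  have cK: "cnj (K $$ (i, j)) = K $$ (j, i)" if "i < n" "j < n" for i j
    using mat_adjoint_index[of j K i] K that by simp
  have cL: "cnj (L $$ (i, j)) = L $$ (j, i)" if "i < n" "j < n" for i j
    using mat_adjoint_index[of j L i] L that by simp
  have t0: "t i j = 0" if "j < i" "i < n" for i j
    using upper_triangularD[OF tri that(1)] that K L by (simp add: t_def)
  have norm: "complex_of_real ((cmod z)\<^sup>2) = z * cnj z" for z
    by (rule complex_norm_square)
  \<comment> \<open>The squared norms of row \<open>i\<close> and column \<open>i\<close> of
    \<open>t\<close> differ only in the sign of a cross term, and this identity makes that term
    vanish.\<close>
  have commi: "(\<Sum>k<n. K $$ (i, k) * L $$ (k, i)) = (\<Sum>k<n. L $$ (i, k) * K $$ (k, i))"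
    if "i < n" for i
    using arg_cong[OF comm, of "\<lambda>M. M $$ (i, i)"] that K L
    by (simp add: scalar_prod_def atLeast0LessThan)
  have "(\<Sum>k<n. (cmod (t i k))\<^sup>2) = (\<Sum>k<n. (cmod (t k i))\<^sup>2)" if i: "i < n" for i
  proof -
    have "complex_of_real (\<Sum>k<n. (cmod (t i k))\<^sup>2)
      = (\<Sum>k<n. (K $$ (i, k) + \<i> * L $$ (i, k)) * (K $$ (k, i) - \<i> * L $$ (k, i)))"
      unfolding of_real_sum norm using i by (intro sum.cong) (auto simp: t_def cK cL)
    also have "\<dots> = (\<Sum>k<n. K $$ (i, k) * K $$ (k, i)) + (\<Sum>k<n. L $$ (i, k) * L $$ (k, i))
      + \<i> * ((\<Sum>k<n. L $$ (i, k) * K $$ (k, i)) - (\<Sum>k<n. K $$ (i, k) * L $$ (k, i)))"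
      by (simp add: algebra_simps sum.distrib sum_subtractf sum_distrib_left)
    also have "\<dots> = (\<Sum>k<n. K $$ (i, k) * K $$ (k, i)) + (\<Sum>k<n. L $$ (i, k) * L $$ (k, i))
      + \<i> * ((\<Sum>k<n. K $$ (i, k) * L $$ (k, i)) - (\<Sum>k<n. L $$ (i, k) * K $$ (k, i)))"
      by (simp add: commi[OF i])
    also have "\<dots> = (\<Sum>k<n. (K $$ (i, k) - \<i> * L $$ (i, k)) * (K $$ (k, i) + \<i> * L $$ (k, i)))"
      by (simp add: algebra_simps sum.distrib sum_subtractf sum_distrib_left)
    also have "\<dots> = complex_of_real (\<Sum>k<n. (cmod (t k i))\<^sup>2)"
      unfolding of_real_sum norm using i
      by (intro sum.cong) (auto simp: t_def cK cL mult.commute)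
    finally show ?thesis by (simp only: of_real_eq_iff)
  qed
  then have off: "t i j = 0" if "i < n" "j < n" "i \<noteq> j" for i j
    using normal_triangular_offdiag[of n t] t0 that by blast
  have "K $$ (i, j) = 0 \<and> L $$ (i, j) = 0" if ij: "i < n" "j < n" "i \<noteq> j" for i j
  proof -
    have 1: "K $$ (i, j) + \<i> * L $$ (i, j) = 0"
      using off[OF ij] by (simp add: t_def)
    \<comment> \<open>Conjugating the transposed entry turns \<open>K + \<i> L\<close> into
      \<open>K - \<i> L\<close> at \<open>(i, j)\<close>; if both vanish, so do \<open>K\<close> and
      \<open>L\<close> there.\<close>
    have "cnj (t j i) = 0" using off ij by simp
    then have 2: "K $$ (i, j) - \<i> * L $$ (i, j) = 0"
      using ij by (simp add: t_def cK cL)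
    have "2 * K $$ (i, j) = (K $$ (i, j) + \<i> * L $$ (i, j)) + (K $$ (i, j) - \<i> * L $$ (i, j))"
      by simp
    also have "\<dots> = 0" by (simp only: 1 2 add_0)
    finally have "K $$ (i, j) = 0" by simp
    with 2 show ?thesis by simp
  qed
  then show "diagonal_mat K" "diagonal_mat L"
    using K(1) L(1) by (auto simp: diagonal_mat_def)
qed

text \<open>Unitary conjugation preserves self-adjointness, products and linear combinations, so a
  Schur basis of \<open>K + \<i> \<cdot>\<^sub>m L\<close> reduces the claim to the triangular
  case.\<close>

lemma commuting_hermitian_diagonalization:
  fixes K L :: "complex mat"
  assumes K: "K \<in> carrier_mat n n" "mat_adjoint K = K"
    and L: "L \<in> carrier_mat n n" "mat_adjoint L = L"
    and comm: "K * L = L * K"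
  shows "\<exists>U. U \<in> carrier_mat n n \<and> unitary_mat U \<and>
    diagonal_mat (mat_adjoint U * K * U) \<and> diagonal_mat (mat_adjoint U * L * U)"
proof -
  have M: "K + \<i> \<cdot>\<^sub>m L \<in> carrier_mat n n" using K L by simp
  obtain U where U: "U \<in> carrier_mat n n" "unitary_mat U"
    and tri: "upper_triangular (mat_adjoint U * (K + \<i> \<cdot>\<^sub>m L) * U)"
    using unitary_schur[OF M] by blast
  have aU: "mat_adjoint U \<in> carrier_mat n n" using U by simp
  let ?c = "\<lambda>M. mat_adjoint U * M * U"
  have car: "?c M \<in> carrier_mat n n" if "M \<in> carrier_mat n n" for M
    using aU U that by auto
  have adj: "mat_adjoint (?c M) = ?c (mat_adjoint M)" if "M \<in> carrier_mat n n" for M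
    using mat_adjoint_mult[OF mult_carrier_mat[OF aU that] U(1)] mat_adjoint_mult[OF aU that]
      assoc_mult_mat[OF aU mat_adjoint_carrier[OF that] U(1)] by simp
  have mult: "?c M * ?c N = ?c (M * N)"
    if M: "M \<in> carrier_mat n n" and N: "N \<in> carrier_mat n n" for M N
  proof -
    have "?c M * ?c N = mat_adjoint U * (M * U) * (mat_adjoint U * (N * U))"
      by (simp only: assoc_mult_mat[OF aU M U(1)] assoc_mult_mat[OF aU N U(1)])
    also have "\<dots> = mat_adjoint U * (M * (U * mat_adjoint U) * N) * U"
      using aU U(1) M N
      by (simp add: assoc_mult_mat[of _ n n _ n _ n] mult_carrier_mat[of _ n n _ n])
    finally show ?thesis
      using M by (simp add: unitary_mat_right[OF U])
  qed
  have "?c (K + \<i> \<cdot>\<^sub>m L) = ?c K + \<i> \<cdot>\<^sub>m ?c L"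
    using K(1) L(1) aU U(1)
    by (simp add: mult_add_distrib_mat[of _ n n _ n] add_mult_distrib_mat[of _ n n _ _ n]
        mult_smult_distrib[of _ n n _ n] mult_smult_assoc_mat[of _ n n _ n]
        mult_carrier_mat[of _ n n _ n])
  then have "diagonal_mat (?c K)" "diagonal_mat (?c L)"
    using commuting_hermitian_triangular[OF car[OF K(1)] _ car[OF L(1)]] tri
      adj[OF K(1)] adj[OF L(1)] mult[OF K(1) L(1)] mult[OF L(1) K(1)] K(2) L(2) comm by simp_all
  with U show ?thesis by blast
qed

section \<open>Gram matrices and singular values\<close>

lemma gram_mat_diag_entry:
  fixes X :: "complex mat"
  assumes "X \<in> carrier_mat m n" "i < n"
  shows "(mat_adjoint X * X) $$ (i, i) = complex_of_real (\<Sum>k<m. (cmod (X $$ (k, i)))\<^sup>2)"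
  using assms unfolding of_real_sum complex_norm_square
  by (auto simp: scalar_prod_def atLeast0LessThan mult.commute intro!: sum.cong)

abbreviation spectral_mat :: "nat \<Rightarrow> complex mat \<Rightarrow> (nat \<Rightarrow> real) \<Rightarrow> complex mat" where
  "spectral_mat n U d \<equiv> U * mat_diag n (\<lambda>i. complex_of_real (d i)) * mat_adjoint U"

lemma gram_mat_spectral:
  fixes X U :: "complex mat"
  assumes X: "X \<in> carrier_mat n n" and U: "U \<in> carrier_mat n n" "unitary_mat U"
    and diag: "diagonal_mat (mat_adjoint U * (mat_adjoint X * X) * U)"
  shows "\<exists>d. (\<forall>i. 0 \<le> d i) \<and> mat_adjoint X * X = spectral_mat n U d"
proof -
  let ?N = "mat_adjoint U * (mat_adjoint X * X) * U"
  \<comment> \<open>The diagonalized Gram matrix is the Gram matrix of \<open>X * U\<close>, so its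
    diagonal holds squared column lengths. As a sum of squares, \<open>d i\<close> is nonnegative
    for every \<open>i\<close>, even outside the index range.\<close>
  define d where "d i = (\<Sum>k<n. (cmod ((X * U) $$ (k, i)))\<^sup>2)" for i
  have aX: "mat_adjoint X \<in> carrier_mat n n" and aU: "mat_adjoint U \<in> carrier_mat n n"
    using X U by auto
  have G: "mat_adjoint X * X \<in> carrier_mat n n" by (rule mult_carrier_mat[OF aX X])
  have "?N = mat_adjoint (X * U) * (X * U)"
    using X U(1) aX aU
    by (simp add: mat_adjoint_mult[OF X U(1)] assoc_mult_mat[of _ n n _ n _ n]
        mult_carrier_mat[of _ n n _ n])
  then have "?N $$ (i, i) = complex_of_real (d i)" if "i < n" for i
    using gram_mat_diag_entry[of "X * U" n n i] X U that by (simp add: d_def)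
  then have N: "?N = mat_diag n (\<lambda>i. complex_of_real (d i))"
    using diag U X unfolding diagonal_mat_def by (intro eq_matI) (auto simp: mat_diag_def)
  have "mat_adjoint X * X = U * ?N * mat_adjoint U"
    using assoc_mult_mat5[OF U(1) aU G U(1) aU] left_mult_one_mat[OF G] right_mult_one_mat[OF G]
    by (simp only: unitary_mat_right[OF U])
  then have "mat_adjoint X * X = spectral_mat n U d" by (simp only: N)
  moreover have "\<forall>i. 0 \<le> d i" by (simp add: d_def sum_nonneg)
  ultimately show ?thesis by blast
qed

text \<open>Unitary conjugation is a similarity, so the characteristic polynomial is that of the
  diagonal matrix and its roots are the \<open>d i\<close> with multiplicity.\<close>

lemma singular_values_spectral:
  assumes U: "U \<in> carrier_mat n n" "unitary_mat U"
    and eq: "mat_adjoint X * X = spectral_mat n U d"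
  shows "singular_values X = vec_of_list (rev (sort (map (\<lambda>i. sqrt (d i)) [0..<n])))"
proof -
  let ?D = "mat_diag n (\<lambda>i. complex_of_real (d i))"
  have D: "?D \<in> carrier_mat n n" by simp
  have "similar_mat (spectral_mat n U d) ?D"
    using U unitary_mat_right[OF U]
    by (intro similar_matI[of _ _ U "mat_adjoint U" n]) auto
  then have "char_poly (mat_adjoint X * X) = char_poly ?D"
    unfolding eq by (rule char_poly_similar)
  also have "\<dots> = (\<Prod>a\<leftarrow>map (\<lambda>i. complex_of_real (d i)) [0..<n]. [:- a, 1:])"
    by (subst char_poly_upper_triangular[OF D])
       (auto simp: mat_diag_def diag_mat_def intro!: arg_cong[of _ _ prod_list])
  finally have "proots (char_poly (mat_adjoint X * X))
      = proots (\<Prod>p\<leftarrow>map (\<lambda>i. [:- complex_of_real (d i), 1:]) [0..<n]. p)"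
    by (simp add: comp_def)
  also have "\<dots> = mset (map (\<lambda>i. complex_of_real (d i)) [0..<n])"
    by (subst proots_prod_list) (auto simp: comp_def sum_list_sum_nth sum_unfold_sum_mset)
  finally show ?thesis
    by (simp only: singular_values_def mset_map[symmetric] sorted_list_of_multiset_mset
        map_map comp_def Re_complex_of_real)
qed

lemma mat_trace_spectral:
  assumes U: "U \<in> carrier_mat n n" "unitary_mat U"
  shows "mat_trace (spectral_mat n U d) = complex_of_real (\<Sum>i<n. d i)"
proof -
  have "mat_trace (spectral_mat n U d)
    = (\<Sum>i<n. \<Sum>k<n. U $$ (i, k) * complex_of_real (d k) * cnj (U $$ (i, k)))"
    using U by (simp add: mat_trace_def mat_diag_mult_right[of _ n n] scalar_prod_def
        atLeast0LessThan)
  \<comment> \<open>Each \<open>d k\<close> is weighted by the squared length of column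
    \<open>k\<close> of \<open>U\<close>, which is 1.\<close>
  also have "\<dots> = (\<Sum>k<n. complex_of_real (d k) * (mat_adjoint U * U) $$ (k, k))"
    using U by (subst sum.swap)
      (auto simp: scalar_prod_def atLeast0LessThan sum_distrib_left algebra_simps intro!: sum.cong)
  also have "\<dots> = complex_of_real (\<Sum>i<n. d i)"
    by (simp add: unitary_mat_right[OF U])
  finally show ?thesis .
qed

text \<open>The functional calculus acts on \<open>d\<close> alone and the trace sums the result;
  this sum is nonnegative, so the exponents \<open>1 / p\<close> and \<open>p\<close>
  cancel.\<close>

lemma schatten_norm_spectral:
  assumes U: "U \<in> carrier_mat n n" "unitary_mat U" and d: "\<And>i. 0 \<le> d i"
    and eq: "mat_adjoint X * X = spectral_mat n U d" and p: "p \<noteq> 0"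
  shows "schatten_norm p X powr p = (\<Sum>i<n. d i powr (p / 2))"
  using p psd_powr_eq[OF U d] mat_trace_spectral[OF U]
  by (simp add: schatten_norm_def eq powr_powr sum_nonneg)

lemma vec_pnorm_powr: "p \<noteq> 0 \<Longrightarrow> vec_pnorm p v powr p = (\<Sum>i<dim_vec v. \<bar>v $ i\<bar> powr p)"
  by (simp add: vec_pnorm_def powr_powr sum_nonneg)

text \<open>The cross terms of both squares are \<open>A * B + B * A\<close> up to sign. Moving
  \<open>B\<close> past \<open>A * A\<close> changes the sign twice, so \<open>A * A\<close>
  commutes with \<open>B\<close> and hence with \<open>B * B\<close>.\<close>

lemma anticommuting_gram:
  fixes A B :: "complex mat"
  assumes A: "A \<in> carrier_mat n n" "mat_adjoint A = A"
    and B: "B \<in> carrier_mat n n" "mat_adjoint B = B"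
    and anti: "A * B + B * A = 0\<^sub>m n n"
  shows "mat_adjoint (A + B) * (A + B) = mat_adjoint A * A + mat_adjoint B * B"
    and "mat_adjoint (A - B) * (A - B) = mat_adjoint A * A + mat_adjoint B * B"
    and "(mat_adjoint A * A) * (mat_adjoint B * B) = (mat_adjoint B * B) * (mat_adjoint A * A)"
proof -
  have entry: "cnj (A $$ (i, j)) = A $$ (j, i)" "cnj (B $$ (i, j)) = B $$ (j, i)"
    if "i < n" "j < n" for i j
    using mat_adjoint_index[of j A i] mat_adjoint_index[of j B i] A B that by simp_all
  have adj: "mat_adjoint (A + B) = A + B" "mat_adjoint (A - B) = A - B"
    using A(1) B(1) by (auto intro!: eq_matI simp: entry)
  have anti': "(\<Sum>k<n. A $$ (i, k) * B $$ (k, j)) = - (\<Sum>k<n. B $$ (i, k) * A $$ (k, j))"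
    if "i < n" "j < n" for i j
    using arg_cong[OF anti, of "\<lambda>M. M $$ (i, j)"] that A(1) B(1)
    by (simp add: scalar_prod_def atLeast0LessThan eq_neg_iff_add_eq_0)
  show "mat_adjoint (A + B) * (A + B) = mat_adjoint A * A + mat_adjoint B * B"
    unfolding adj A(2) B(2) using A(1) B(1)
    by (intro eq_matI)
       (auto simp: scalar_prod_def atLeast0LessThan algebra_simps sum.distrib anti')
  show "mat_adjoint (A - B) * (A - B) = mat_adjoint A * A + mat_adjoint B * B"
    unfolding adj A(2) B(2) using A(1) B(1)
    by (intro eq_matI)
       (auto simp: scalar_prod_def atLeast0LessThan algebra_simps sum.distrib sum_subtractf anti')
  have AB: "A * B = - (B * A)"
    using A(1) B(1) anti' by (intro eq_matI) (auto simp: scalar_prod_def atLeast0LessThan)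
  note assoc = assoc_mult_mat[of _ n n _ n _ n]
  have "A * (A * B) = A * - (B * A)" by (simp only: AB)
  also have "\<dots> = - (A * B * A)" using A(1) B(1) by (simp add: assoc)
  also have "\<dots> = B * (A * A)"
    unfolding AB using A(1) B(1) by simp
  finally have *: "A * (A * B) = B * (A * A)" .
  have "(A * A) * (B * B) = (A * (A * B)) * B"
    using A(1) B(1) by (simp add: assoc)
  also have "\<dots> = B * (A * (A * B))"
    using A(1) B(1) by (simp add: * assoc)
  also have "\<dots> = (B * B) * (A * A)"
    using A(1) B(1) by (simp add: * assoc)
  finally show "(mat_adjoint A * A) * (mat_adjoint B * B) = (mat_adjoint B * B) * (mat_adjoint A * A)"
    by (simp only: A(2) B(2))
qed

lemma spectral_mat_add:
  assumes "U \<in> carrier_mat n n"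
  shows "spectral_mat n U a + spectral_mat n U b = spectral_mat n U (\<lambda>i. a i + b i)"
proof -
  have "mat_diag n (\<lambda>i. complex_of_real (a i + b i))
    = mat_diag n (\<lambda>i. complex_of_real (a i)) + mat_diag n (\<lambda>i. complex_of_real (b i))"
    by (intro eq_matI) (auto simp: mat_diag_def)
  then show ?thesis
    using assms by (simp add: mult_add_distrib_mat[of _ n n _ n] add_mult_distrib_mat[of _ n n _ _ n])
qed

section \<open>Comparison of the two sides\<close>

theorem theorem3p3:
  fixes n :: nat and A B :: "complex mat" and p :: real
  assumes "A \<in> carrier_mat n n" and "B \<in> carrier_mat n n"
    and "self_adjoint_mat A" and "self_adjoint_mat B"
    and "A * B + B * A = 0\<^sub>m n n"
  shows "(1 \<le> p \<and> p \<le> 2 \<longrightarrow>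
      schatten_norm p (A + B) powr p + schatten_norm p (A - B) powr p
      \<ge> vec_pnorm p (singular_values A + singular_values B) powr p
        + vec_pnorm p (singular_values A - singular_values B) powr p) \<and>
    (2 \<le> p \<longrightarrow>
      schatten_norm p (A + B) powr p + schatten_norm p (A - B) powr p
      \<le> vec_pnorm p (singular_values A + singular_values B) powr p
        + vec_pnorm p (singular_values A - singular_values B) powr p)"
proof -
  note A = assms(1) and B = assms(2)
  have adj: "mat_adjoint A = A" "mat_adjoint B = B"
    using assms(3,4) by (simp_all add: self_adjoint_mat_def)
  note gram = anticommuting_gram[OF A adj(1) B adj(2) assms(5)]
  have herm: "mat_adjoint X * X \<in> carrier_mat n n"
    "mat_adjoint (mat_adjoint X * X) = mat_adjoint X * X" if X: "X \<in> carrier_mat n n"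
    for X :: "complex mat"
    using mult_carrier_mat[OF mat_adjoint_carrier[OF X] X]
      mat_adjoint_mult[OF mat_adjoint_carrier[OF X] X] by simp_all
  obtain U where U: "U \<in> carrier_mat n n" "unitary_mat U"
    and diag: "diagonal_mat (mat_adjoint U * (mat_adjoint A * A) * U)"
      "diagonal_mat (mat_adjoint U * (mat_adjoint B * B) * U)"
    using commuting_hermitian_diagonalization[OF herm[OF A] herm[OF B] gram(3)] by blast
  \<comment> \<open>\<open>a\<close> and \<open>b\<close> below are the squared singular values,
    paired by the common basis \<open>U\<close>; this pairing need not respect their order.\<close>
  obtain a where a: "\<And>i. 0 \<le> a i" "mat_adjoint A * A = spectral_mat n U a"
    using gram_mat_spectral[OF A U diag(1)] by blast
  obtain b where b: "\<And>i. 0 \<le> b i" "mat_adjoint B * B = spectral_mat n U b"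
    using gram_mat_spectral[OF B U diag(2)] by blast
  have ab: "0 \<le> a i + b i" for i using a(1)[of i] b(1)[of i] by simp
  define S where "S = rev (sort (map (\<lambda>i. sqrt (a i)) [0..<n]))"
  define T where "T = rev (sort (map (\<lambda>i. sqrt (b i)) [0..<n]))"
  have len: "length S = n" "length T = n" by (simp_all add: S_def T_def)
  have sv: "singular_values A = vec_of_list S" "singular_values B = vec_of_list T"
    using singular_values_spectral[OF U a(2)] singular_values_spectral[OF U b(2)]
    by (simp_all add: S_def T_def)
  let ?L = "schatten_norm p (A + B) powr p + schatten_norm p (A - B) powr p"
  let ?R = "vec_pnorm p (singular_values A + singular_values B) powr p
        + vec_pnorm p (singular_values A - singular_values B) powr p"
  have rearr: "2 * (\<Sum>i<n. h (a i + b i)) \<le> (\<Sum>i<n. h ((S ! i + T ! i)\<^sup>2) + h ((S ! i - T ! i)\<^sup>2))"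
    if "\<And>x y s. 0 \<le> x \<Longrightarrow> x \<le> y \<Longrightarrow> 0 \<le> s \<Longrightarrow> h (x + s) - h x \<le> h (y + s) - h y"
    for h :: "real \<Rightarrow> real"
    using sum_squares_rearrangement[of h "\<lambda>i. sqrt (a i)" "\<lambda>i. sqrt (b i)" n] that a(1) b(1)
    by (simp add: S_def T_def)
  have L: "?L = 2 * (\<Sum>i<n. (a i + b i) powr (p / 2))"
    and R: "?R = (\<Sum>i<n. ((S ! i + T ! i)\<^sup>2) powr (p / 2) + ((S ! i - T ! i)\<^sup>2) powr (p / 2))"
    if "p \<noteq> 0"
  proof -
    \<comment> \<open>\<open>A + B\<close> and \<open>A - B\<close> have the same Gram matrix, which
      accounts for the factor 2.\<close>
    have "mat_adjoint (A + B) * (A + B) = spectral_mat n U (\<lambda>i. a i + b i)"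
      "mat_adjoint (A - B) * (A - B) = spectral_mat n U (\<lambda>i. a i + b i)"
      by (simp_all only: gram a(2) b(2) spectral_mat_add[OF U(1)])
    then show "?L = 2 * (\<Sum>i<n. (a i + b i) powr (p / 2))"
      using schatten_norm_spectral[OF U ab _ that] by simp
    show "?R = (\<Sum>i<n. ((S ! i + T ! i)\<^sup>2) powr (p / 2) + ((S ! i - T ! i)\<^sup>2) powr (p / 2))"
      using that by (simp add: vec_pnorm_powr sv len vec_of_list_index powr_half_square sum.distrib)
  qed
  show ?thesis
  proof (intro conjI impI)
    assume p: "1 \<le> p \<and> p \<le> 2"
    \<comment> \<open>For \<open>p / 2 \<le> 1\<close> the increments of the power are
      nonincreasing, so \<open>rearr\<close> is applied to its negative and the inequality
      flips.\<close>
    have "2 * (\<Sum>i<n. - ((a i + b i) powr (p / 2)))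
      \<le> (\<Sum>i<n. - (((S ! i + T ! i)\<^sup>2) powr (p / 2)) + - (((S ! i - T ! i)\<^sup>2) powr (p / 2)))"
    proof (rule rearr)
      fix x y s :: real assume "0 \<le> x" "x \<le> y" "0 \<le> s"
      then show "- ((x + s) powr (p / 2)) - - (x powr (p / 2))
        \<le> - ((y + s) powr (p / 2)) - - (y powr (p / 2))"
        using powr_increment(2)[of "p / 2" x y s] p by simp
    qed
    then show "?R \<le> ?L"
      using p by (simp add: L R sum_negf sum.distrib sum_subtractf)
  next
    assume p: "2 \<le> p"
    show "?L \<le> ?R"
      using rearr[of "\<lambda>x. x powr (p / 2)"] powr_increment(1)[of "p / 2"] p by (simp add: L R)
  qed
qed

end
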